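(* Let $k>0$ be real and let $\lambda,\alpha,\beta,\gamma,\delta\in\mathbb{C}$ with $\beta,\delta\notin\{0,-k,-2k,\dots\}$. Let $x,y,t\in\mathbb{C}$ satisfy $|x|<\frac1k$, $|t|<\frac1k$ and $\left|\frac{x}{1-kt}\right|+\left|\frac{kyt}{1-kt}\right|<\frac1k$, and suppose the series in $n$ on the left-hand side below converges absolutely. Then $$\sum_{n=0}^\infty\frac{(\lambda)_{n,k}}{n!}\,{}_2F_{1,k}\left[\begin{array}{c}\lambda+nk,\ \alpha\\ \beta\end{array};x\right]{}_2F_{1,k}\left[\begin{array}{c}-nk,\ \gamma\\ \delta\end{array};y\right]t^n=(1-kt)^{-\frac{\lambda}{k}}F_{2,k}\left(\lambda,\alpha,\gamma;\beta,\delta;\frac{x}{1-kt},-\frac{kyt}{1-kt}\right).$$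
   Context: For real $k>0$, $a\in\mathbb{C}$ and an integer $n\ge 1$, the Pochhammer $k$-symbol is $(a)_{n,k}=a(a+k)(a+2k)\cdots(a+(n-1)k)$, and $(a)_{0,k}=1$. The $k$-hypergeometric function is $${}_2F_{1,k}\left[\begin{array}{c}\alpha,\ \beta\\ \gamma\end{array};x\right]=\sum_{n=0}^\infty\frac{(\alpha)_{n,k}(\beta)_{n,k}}{(\gamma)_{n,k}}\frac{x^n}{n!},$$ for $|x|<\frac1k$, or for any $x\in\mathbb{C}$ when the series terminates (as it does when an upper parameter equals $-nk$ with $n$ a nonnegative integer). The second Appell $k$-function is $$F_{2,k}(\alpha,\beta,\beta';\gamma,\gamma';x,y)=\sum_{m,n=0}^\infty\frac{(\alpha)_{m+n,k}(\beta)_{m,k}(\beta')_{n,k}}{(\gamma)_{m,k}(\gamma')_{n,k}}\frac{x^m}{m!}\frac{y^n}{n!},\qquad |x|+|y|<\tfrac1k.$$ Complex powers are principal values. *)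

theory Defs
  imports "HOL-Analysis.Analysis"
begin

definition pochhammer_k :: "real \<Rightarrow> complex \<Rightarrow> nat \<Rightarrow> complex" where
  "pochhammer_k k a n = (\<Prod>i<n. a + of_nat i * of_real k)"

text \<open>
  The power series below carries no convergence hypothesis; it is meaningful for
  \<open>norm x < 1 / k\<close>, and for every \<open>x\<close> when it terminates. The lower parameter
  must avoid \<open>0, -k, -2k, \<dots>\<close>, since otherwise division by zero sets terms to zero.
\<close>

definition hyp2F1_k :: "real \<Rightarrow> complex \<Rightarrow> complex \<Rightarrow> complex \<Rightarrow> complex \<Rightarrow> complex" where
  "hyp2F1_k k a b c x =
     (\<Sum>n. pochhammer_k k a n * pochhammer_k k b n / pochhammer_k k c n * (x ^ n / fact n))"

text \<open>
  The double series is an unordered sum over all pairs, which for complex terms means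
  absolute convergence; it is meaningful for \<open>norm x + norm y < 1 / k\<close>.
\<close>

definition appellF2_k ::
  "real \<Rightarrow> complex \<Rightarrow> complex \<Rightarrow> complex \<Rightarrow> complex \<Rightarrow> complex \<Rightarrow> complex \<Rightarrow> complex \<Rightarrow> complex" where
  "appellF2_k k a b b' c c' x y =
     (\<Sum>\<^sub>\<infinity>(m, n)\<in>UNIV.
        pochhammer_k k a (m + n) * pochhammer_k k b m * pochhammer_k k b' n
          / (pochhammer_k k c m * pochhammer_k k c' n)
          * (x ^ m / fact m) * (y ^ n / fact n))"

end

theory Submission
  imports Defs "HOL-Complex_Analysis.Complex_Analysis"
begin

text \<open>
  Replacing \<open>x, y, t\<close> by \<open>k x, k y, k t\<close> and dividing all parameters by \<open>k\<close> reduces the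
  statement to \<open>k = 1\<close>. The quotients \<open>A i = (\<alpha>)_i / (\<beta>)_i\<close> and \<open>B j = (\<gamma>)_j / (\<delta>)_j\<close>
  enter only through their growth, so they are replaced by arbitrary sequences that grow more slowly
  than every \<open>q ^ n\<close> with \<open>q > 1\<close>.

  For small \<open>t\<close> both sides are rearrangements of one triple series. Since
  \<open>(a)_n (a + n)_i = (a)_(n + i)\<close> and \<open>(- n)_j / n! = (- 1) ^ j / (n - j)!\<close>, writing \<open>n = j + p\<close>
  turns the left-hand side into the sum over \<open>i, j, p\<close> of
  \<open>(a)_(i + j + p) A i B j x ^ i / i! * (- y t) ^ j / j! * t ^ p / p!\<close>, and
  the binomial series in \<open>p\<close> collapses this to the right-hand side. The triple series is dominated by a
  multinomial series, so the rearrangement is legitimate when \<open>|x| + |y t| + |t| < 1\<close>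
  (\<open>appell_generating_function_near_0\<close>).

  This is stronger than what is known about the given \<open>t\<close>: there only the outer series over \<open>n\<close>
  converges absolutely, and the triple series may diverge. The gap is bridged by analytic continuation
  in \<open>t\<close>. The left-hand side is a power series in \<open>t\<close>, hence holomorphic in the open disc of radius
  \<open>|t|\<close> and continuous on its closure. The right-hand side is holomorphic where
  \<open>|x| + |y| |z| < |1 - z|\<close> (\<open>appell_sum_holomorphic\<close>). The part of that region inside the disc is
  not star-shaped about the origin in general, because \<open>|1 - z|\<close> can dip along a radius; it is
  nevertheless connected (\<open>appell_disc_region_connected\<close>). So both sides agree on that part, and letting
  \<open>z\<close> tend to \<open>t\<close> along the radius gives equality at \<open>t\<close> itself
  (\<open>appell_generating_function\<close>).
\<close>

section \<open>Sequences of subexponential growth\<close>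

text \<open>
  Equivalently, the power series with coefficients \<open>s n\<close> has radius of convergence at least \<open>1\<close>.
  The explicit bound is what allows products of several such sequences to be estimated together.
\<close>

definition subexponential :: "(nat \<Rightarrow> complex) \<Rightarrow> bool" where
  "subexponential s \<longleftrightarrow> (\<forall>q>1. \<exists>C. \<forall>n. norm (s n) \<le> C * q ^ n)"

text \<open>
  Appell's second function for \<open>k = 1\<close>, with the quotients of Pochhammer symbols in the single indices
  replaced by coefficient sequences \<open>A\<close> and \<open>B\<close>.
\<close>

definition appell_sum ::
  "complex \<Rightarrow> (nat \<Rightarrow> complex) \<Rightarrow> (nat \<Rightarrow> complex) \<Rightarrow> complex \<Rightarrow> complex \<Rightarrow> complex" where
  "appell_sum a A B x y = (\<Sum>\<^sub>\<infinity>(i, j)\<in>UNIV.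
     pochhammer a (i + j) * A i * B j * (x ^ i / fact i) * (y ^ j / fact j))"

lemma subexponentialD:
  assumes "subexponential s" "q > 1"
  obtains C where "C \<ge> 0" "\<And>n. norm (s n) \<le> C * q ^ n"
proof -
  obtain C where C: "\<And>n. norm (s n) \<le> C * q ^ n"
    using assms unfolding subexponential_def by blast
  have "0 \<le> C" using order_trans[OF norm_ge_zero C[of 0]] by simp
  with C that show thesis by blast
qed

text \<open>
  Consecutive terms have ratio \<open>(a + n) / (b + n)\<close>, which tends to \<open>1\<close>.
\<close>

lemma subexponential_pochhammer_quotient:
  fixes a b :: complex
  assumes b: "\<And>n::nat. b \<noteq> - of_nat n"
  shows "subexponential (\<lambda>n. pochhammer a n / pochhammer b n)"
  unfolding subexponential_def
proof (intro allI impI)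
  fix q :: real assume q: "q > 1"
  define s where "s = (\<lambda>n. norm (pochhammer a n / pochhammer b n))"
  have nz: "b + of_nat n \<noteq> 0" for n
    using b[of n] by (metis add_eq_0_iff2)
  have step: "s (Suc n) = s n * (norm (a + of_nat n) / norm (b + of_nat n))" for n
    by (simp add: s_def pochhammer_Suc norm_mult norm_divide)
  have "(\<lambda>n. 1 + (a - b) / (b + of_nat n)) \<longlonglongrightarrow> 1 + 0"
    by (intro tendsto_intros tendsto_divide_0 [OF tendsto_const]
        tendsto_add_filterlim_at_infinity [OF tendsto_const] tendsto_of_nat)
  moreover have "1 + (a - b) / (b + of_nat n) = (a + of_nat n) / (b + of_nat n)" for n
    using nz[of n] by (simp add: field_simps)
  ultimately have "(\<lambda>n. norm ((a + of_nat n) / (b + of_nat n))) \<longlonglongrightarrow> norm (1::complex)"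
    by (intro tendsto_norm) simp
  then have "eventually (\<lambda>n. norm ((a + of_nat n) / (b + of_nat n)) < q) sequentially"
    using q by (intro order_tendstoD) auto
  then obtain N where N: "\<And>n. n \<ge> N \<Longrightarrow> norm (a + of_nat n) / norm (b + of_nat n) \<le> q"
    by (auto simp: eventually_sequentially norm_divide intro: less_imp_le)
  define C where "C = Max (s ` {..N})"
  have C: "s n \<le> C" if "n \<le> N" for n
    unfolding C_def using that by (intro Max_ge) auto
  have C0: "C \<ge> 0" using C[of 0] by (simp add: s_def)
  have "s n \<le> C * q ^ n" for n
  proof (induction n)
    case 0 then show ?case using C[of 0] by simp
  next
    case (Suc n)
    show ?case
    proof (cases "Suc n \<le> N")
      case True
      then have "s (Suc n) \<le> C * 1" using C by simp
      also have "\<dots> \<le> C * q ^ Suc n"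
        using q C0 by (intro mult_left_mono one_le_power) auto
      finally show ?thesis .
    next
      case False
      have "s (Suc n) \<le> (C * q ^ n) * q"
        unfolding step using Suc False N[of n] q C0
        by (intro mult_mono) auto
      then show ?thesis by (simp add: mult_ac)
    qed
  qed
  then show "\<exists>C. \<forall>n. norm (pochhammer a n / pochhammer b n) \<le> C * q ^ n"
    unfolding s_def by blast
qed

lemma subexponential_mult:
  assumes "subexponential s" "subexponential s'"
  shows "subexponential (\<lambda>n. s n * s' n)"
  unfolding subexponential_def
proof (intro allI impI)
  fix q :: real assume q: "q > 1"
  then have "sqrt q > 1" by simp
  obtain C where C: "C \<ge> 0" "\<And>n. norm (s n) \<le> C * sqrt q ^ n"
    using subexponentialD[OF assms(1) \<open>sqrt q > 1\<close>] by blast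
  obtain C' where C': "C' \<ge> 0" "\<And>n. norm (s' n) \<le> C' * sqrt q ^ n"
    using subexponentialD[OF assms(2) \<open>sqrt q > 1\<close>] by blast
  have "norm (s n * s' n) \<le> (C * C') * q ^ n" for n
  proof -
    have "norm (s n * s' n) \<le> (C * sqrt q ^ n) * (C' * sqrt q ^ n)"
      unfolding norm_mult using C C' q by (intro mult_mono) auto
    also have "\<dots> = (C * C') * (sqrt q * sqrt q) ^ n"
      by (simp only: power_mult_distrib mult_ac)
    finally show ?thesis using q by simp
  qed
  then show "\<exists>C. \<forall>n. norm (s n * s' n) \<le> C * q ^ n" by blast
qed

lemma subexponential_pochhammer_fact: "subexponential (\<lambda>n. pochhammer a n / fact n)"
proof -
  have "(1::complex) \<noteq> - of_nat n" for n
  proof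
    assume "(1::complex) = - of_nat n"
    then have "Re 1 = Re (- of_nat n)" by (rule arg_cong)
    then show False by simp
  qed
  from subexponential_pochhammer_quotient[OF this, of a] show ?thesis
    by (simp add: pochhammer_fact)
qed

section \<open>Absolute convergence of the multiple series\<close>

lemma subexponential_power_series_summable:
  assumes s: "subexponential s" and z: "norm (z::complex) < 1"
  shows "summable (\<lambda>n. norm (s n * z ^ n))"
proof -
  \<comment> \<open>\<open>1 / q\<close> is the midpoint of \<open>|z|\<close> and \<open>1\<close>.\<close>
  define q where "q = 2 / (1 + norm z)"
  have q: "q > 1" "q * norm z < 1"
    using z by (auto simp: q_def field_simps add_pos_nonneg)
  obtain C where C: "\<And>n. norm (s n) \<le> C * q ^ n"
    using subexponentialD[OF s q(1)] by blast
  have "summable (\<lambda>n. C * (q * norm z) ^ n)"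
    using q by (intro summable_mult summable_geometric) auto
  then show ?thesis
  proof (rule summable_comparison_test'[where N = 0])
    fix n
    have "norm (s n * z ^ n) \<le> C * (q * norm z) ^ n"
      using mult_right_mono[OF C[of n], of "norm z ^ n"]
      by (simp add: norm_mult norm_power power_mult_distrib mult_ac)
    then show "norm (norm (s n * z ^ n)) \<le> C * (q * norm z) ^ n" by simp
  qed
qed

text \<open>
  Summing along the diagonals \<open>i + j = N\<close> gives the geometric series of \<open>u + v\<close>.
\<close>

lemma binomial_double_series_summable:
  fixes u v :: real
  assumes "0 \<le> u" "0 \<le> v" "u + v < 1"
  shows "(\<lambda>(i, j). of_nat (i + j choose i) * u ^ i * v ^ j) summable_on UNIV"
proof -
  let ?f = "\<lambda>(N, i). of_nat (N choose i) * u ^ i * v ^ (N - i)"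
  have "?f summable_on Sigma UNIV (\<lambda>N. {..N})"
  proof (rule summable_on_SigmaI)
    show "((\<lambda>i. ?f (N, i)) has_sum (u + v) ^ N) {..N}" for N
      by (intro has_sum_finiteI) (auto simp: binomial_ring)
    show "(\<lambda>N. (u + v) ^ N) summable_on UNIV"
      using assms by (intro summable_nonneg_imp_summable_on summable_geometric) auto
  qed (use assms in auto)
  also have "?this \<longleftrightarrow> ?thesis"
    by (rule summable_on_reindex_bij_witness
        [where i = "\<lambda>(i, j). (i + j, i)" and j = "\<lambda>(N, i). (i, N - i)"]) auto
  finally show ?thesis .
qed

text \<open>
  With \<open>N = i + j\<close>, summing over \<open>i\<close> first leaves the double series for \<open>u + v\<close> and \<open>w\<close>.
\<close>

lemma trinomial_series_summable:
  fixes u v w :: real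
  assumes "0 \<le> u" "0 \<le> v" "0 \<le> w" "u + v + w < 1"
  shows "(\<lambda>((i, j), p). fact (i + j + p) * (u ^ i / fact i) * (v ^ j / fact j) * (w ^ p / fact p))
           summable_on UNIV"
proof -
  let ?f = "\<lambda>((N, p), i). of_nat (N + p choose N) * w ^ p * (of_nat (N choose i) * u ^ i * v ^ (N - i))"
  have "?f summable_on Sigma UNIV (\<lambda>(N, p). {..N})"
  proof (rule summable_on_SigmaI)
    show "((\<lambda>i. ?f (Np, i)) has_sum (case Np of (N, p) \<Rightarrow> of_nat (N + p choose N) * (u + v) ^ N * w ^ p))
            (case Np of (N, p) \<Rightarrow> {..N})" for Np
      by (cases Np, intro has_sum_finiteI)
        (auto simp: binomial_ring sum_distrib_left sum_distrib_right mult_ac)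
    show "(\<lambda>(N, p). of_nat (N + p choose N) * (u + v) ^ N * w ^ p) summable_on UNIV"
      using assms by (intro binomial_double_series_summable) auto
  qed (use assms in auto)
  also have "?this \<longleftrightarrow> ?thesis"
  proof (rule summable_on_reindex_bij_witness
        [where i = "\<lambda>((i, j), p). ((i + j, p), i)" and j = "\<lambda>((N, p), i). ((i, N - i), p)"])
    fix a :: "(nat \<times> nat) \<times> nat" assume a: "a \<in> Sigma UNIV (\<lambda>(N, p). {..N})"
    obtain N p i where [simp]: "a = ((N, p), i)" by (metis surj_pair)
    have "i \<le> N" using a by simp
    then show "(\<lambda>((i, j), p). fact (i + j + p) * (u ^ i / fact i) * (v ^ j / fact j) * (w ^ p / fact p))
        ((\<lambda>((N, p), i). ((i, N - i), p)) a) = ?f a"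
      by (simp add: binomial_fact field_simps)
  qed auto
  finally show ?thesis .
qed

text \<open>
  The symbol \<open>(a)_N\<close> differs from \<open>N!\<close> only by a subexponential factor, so the trinomial series
  with slightly enlarged arguments is a majorant.
\<close>

lemma pochhammer_triple_series_summable:
  fixes u v w :: real
  assumes A: "subexponential A" and B: "subexponential B"
    and uvw: "0 \<le> u" "0 \<le> v" "0 \<le> w" "u + v + w < 1"
  shows "(\<lambda>((i, j), p). norm (pochhammer a (i + j + p) * A i * B j)
           * (u ^ i / fact i) * (v ^ j / fact j) * (w ^ p / fact p)) summable_on UNIV"
proof -
  \<comment> \<open>Each argument absorbs one factor \<open>q\<close> from the Pochhammer symbol and at most one from \<open>A\<close> or
      \<open>B\<close>. Hence \<open>q\<^sup>2 * s < 1\<close> is required; for this choice it says \<open>4 * s < (1 + s)\<^sup>2\<close>.\<close>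
  define s where "s = u + v + w"
  define q where "q = 2 / (1 + s)"
  have s: "0 \<le> s" "s < 1" using uvw by (auto simp: s_def)
  have q: "q > 1" using s by (auto simp: q_def field_simps)
  have "0 < (1 - s)\<^sup>2" using s by simp
  then have "4 * s < (1 + s)\<^sup>2" by (simp add: power2_eq_square algebra_simps)
  then have qs: "q\<^sup>2 * s < 1" using s by (simp add: q_def power_divide field_simps)
  obtain CA where CA: "CA \<ge> 0" "\<And>n. norm (A n) \<le> CA * q ^ n"
    using subexponentialD[OF A q] by blast
  obtain CB where CB: "CB \<ge> 0" "\<And>n. norm (B n) \<le> CB * q ^ n"
    using subexponentialD[OF B q] by blast
  obtain CP where CP: "CP \<ge> 0" "\<And>n. norm (pochhammer a n / fact n) \<le> CP * q ^ n"
    using subexponentialD[OF subexponential_pochhammer_fact q] by blast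
  have P: "norm (pochhammer a n) \<le> CP * q ^ n * fact n" for n
    using CP(2)[of n] by (simp add: norm_divide field_simps)
  let ?g = "\<lambda>((i, j), p). fact (i + j + p)
      * ((q\<^sup>2 * u) ^ i / fact i) * ((q\<^sup>2 * v) ^ j / fact j) * ((q\<^sup>2 * w) ^ p / fact p)"
  have "?g summable_on UNIV"
    using uvw qs by (intro trinomial_series_summable) (auto simp: s_def algebra_simps)
  then have "(\<lambda>z. (CP * CA * CB) * ?g z) summable_on UNIV"
    by (rule summable_on_cmult_right)
  then show ?thesis
  proof (rule summable_on_comparison_test)
    fix z :: "(nat \<times> nat) \<times> nat"
    obtain i j p where [simp]: "z = ((i, j), p)" by (metis surj_pair)
    have "norm (pochhammer a (i + j + p) * A i * B j)
        \<le> (CP * q ^ (i + j + p) * fact (i + j + p)) * (CA * q ^ i) * (CB * q ^ j)"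
      unfolding norm_mult using P CA CB CP(1) q
      by (intro mult_mono) auto
    also have "\<dots> = (CP * CA * CB) * fact (i + j + p) * (q\<^sup>2) ^ i * (q\<^sup>2) ^ j * q ^ p"
      by (simp add: power2_eq_square power_mult_distrib power_add mult_ac)
    also have "\<dots> \<le> (CP * CA * CB) * fact (i + j + p) * (q\<^sup>2) ^ i * (q\<^sup>2) ^ j * (q\<^sup>2) ^ p"
      using CP CA CB q
      by (intro mult_left_mono power_mono) (auto simp: power2_eq_square)
    finally have "norm (pochhammer a (i + j + p) * A i * B j)
           * ((u ^ i / fact i) * (v ^ j / fact j) * (w ^ p / fact p))
        \<le> (CP * CA * CB) * fact (i + j + p) * (q\<^sup>2) ^ i * (q\<^sup>2) ^ j * (q\<^sup>2) ^ p
           * ((u ^ i / fact i) * (v ^ j / fact j) * (w ^ p / fact p))"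
      using uvw by (intro mult_right_mono) auto
    then show "(\<lambda>((i, j), p). norm (pochhammer a (i + j + p) * A i * B j)
           * (u ^ i / fact i) * (v ^ j / fact j) * (w ^ p / fact p)) z \<le> (CP * CA * CB) * ?g z"
      by (simp add: power_mult_distrib mult_ac)
  qed (use uvw in auto)
qed

text \<open>
  This is the slice \<open>p = 0\<close> of the triple series, which survives \<open>w = 0\<close> because \<open>0 ^ 0 = 1\<close>.
\<close>

lemma appell_series_summable:
  fixes u v :: real
  assumes "subexponential A" "subexponential B" "0 \<le> u" "0 \<le> v" "u + v < 1"
  shows "(\<lambda>(i, j). norm (pochhammer a (i + j) * A i * B j) * (u ^ i / fact i) * (v ^ j / fact j))
           summable_on UNIV"
proof -
  let ?f = "\<lambda>((i, j), p). norm (pochhammer a (i + j + p) * A i * B j)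
           * (u ^ i / fact i) * (v ^ j / fact j) * (0 ^ p / fact p)"
  have "?f summable_on UNIV"
    using assms by (intro pochhammer_triple_series_summable) auto
  then have "?f summable_on UNIV \<times> {0}"
    by (rule summable_on_subset_banach) simp
  also have "?this \<longleftrightarrow> ?thesis"
    by (rule summable_on_reindex_bij_witness
        [where i = "\<lambda>z. (z, 0)" and j = fst]) auto
  finally show ?thesis .
qed

section \<open>The generating function near the origin\<close>

lemma negative_binomial_series:
  fixes a t :: complex
  assumes t: "norm t < 1"
  shows "((\<lambda>p. pochhammer a p * (t ^ p / fact p)) has_sum (1 - t) powr (- a)) UNIV"
proof (rule norm_summable_imp_has_sum)
  show "summable (\<lambda>p. norm (pochhammer a p * (t ^ p / fact p)))"
    using subexponential_power_series_summable[OF subexponential_pochhammer_fact t, of a]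
    by simp
  have "(\<lambda>n. ((- a) gchoose n) * (- t) ^ n) sums (1 + - t) powr (- a)"
    using t by (intro gen_binomial_complex) simp
  moreover have "((- a) gchoose n) * (- t) ^ n = pochhammer a n * (t ^ n / fact n)" for n
  proof -
    have "((- a) gchoose n) * (- t) ^ n = ((-1) ^ n * (-1) ^ n) * (pochhammer a n * (t ^ n / fact n))"
      unfolding gbinomial_pochhammer power_minus[of t] by simp
    also have "(-1) ^ n * (-1) ^ n = (1::complex)" by (simp add: power_mult_distrib [symmetric])
    finally show ?thesis by simp
  qed
  ultimately show "(\<lambda>p. pochhammer a p * (t ^ p / fact p)) sums (1 - t) powr (- a)"
    by simp
qed

lemma pochhammer_neg_nat:
  assumes "j \<le> n"
  shows "pochhammer (- of_nat n :: complex) j = (-1) ^ j * fact n / fact (n - j)"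
proof -
  have "of_nat (n choose j) = (-1) ^ j * pochhammer (- of_nat n :: complex) j / fact j"
    by (simp add: binomial_gbinomial gbinomial_pochhammer)
  then have "(-1) ^ j * pochhammer (- of_nat n :: complex) j = fact n / fact (n - j)"
    using assms by (simp add: binomial_fact field_simps)
  then have "(-1) ^ j * ((-1) ^ j * pochhammer (- of_nat n :: complex) j) = (-1) ^ j * fact n / fact (n - j)"
    by simp
  then show ?thesis by (simp add: mult.assoc [symmetric] power_mult_distrib [symmetric])
qed

text \<open>
  The absolutely convergent triple series \<open>G\<close> is summed in two ways: over \<open>p\<close> first by the binomial
  series, which produces the powers of \<open>1 - t\<close> in the arguments on the right, and along the slices
  \<open>j + p = n\<close>, on which it splits into the product of the two series on the left.
\<close>

theorem appell_generating_function_near_0: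
  fixes a x y t :: complex
  assumes A: "subexponential A" and B: "subexponential B"
    and small: "norm x + norm (y * t) + norm t < 1"
  shows "(\<lambda>n. pochhammer a n / fact n
            * (\<Sum>i. pochhammer (a + of_nat n) i * A i * (x ^ i / fact i))
            * (\<Sum>j. pochhammer (- of_nat n) j * B j * (y ^ j / fact j)) * t ^ n)
         sums ((1 - t) powr (- a) * appell_sum a A B (x / (1 - t)) (- (y * t / (1 - t))))"
proof -
  have x: "norm x < 1" and t: "norm t < 1"
    using small norm_ge_zero[of x] norm_ge_zero[of "y * t"] norm_ge_zero[of t] by linarith+
  have t1: "1 - t \<noteq> 0" using t by auto
  define G where "G = (\<lambda>((i, j), p). pochhammer a (i + j + p) * A i * B j
      * (x ^ i / fact i) * ((- (y * t)) ^ j / fact j) * (t ^ p / fact p))"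
  have "(\<lambda>z. norm (G z)) = (\<lambda>((i, j), p). norm (pochhammer a (i + j + p) * A i * B j)
           * (norm x ^ i / fact i) * (norm (y * t) ^ j / fact j) * (norm t ^ p / fact p))"
    by (auto simp: G_def fun_eq_iff norm_mult norm_divide norm_power)
  then have "(\<lambda>z. norm (G z)) summable_on UNIV"
    using pochhammer_triple_series_summable[OF A B _ _ _ small, of a] by simp
  then have summ: "G summable_on UNIV" by (rule abs_summable_summable)

  define R where "R = (\<lambda>(i, j). pochhammer a (i + j) * A i * B j
      * ((x / (1 - t)) ^ i / fact i) * ((- (y * t / (1 - t))) ^ j / fact j))"
  have inner: "((\<lambda>p. G (z, p)) has_sum (1 - t) powr (- a) * R z) UNIV" for z
  proof -
    obtain i j where [simp]: "z = (i, j)" by (metis surj_pair)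
    let ?c = "pochhammer a (i + j) * A i * B j * (x ^ i / fact i) * ((- (y * t)) ^ j / fact j)"
    have "((\<lambda>p. ?c * (pochhammer (a + of_nat (i + j)) p * (t ^ p / fact p)))
        has_sum ?c * (1 - t) powr (- (a + of_nat (i + j)))) UNIV"
      by (intro has_sum_cmult_right negative_binomial_series t)
    moreover have "?c * (pochhammer (a + of_nat (i + j)) p * (t ^ p / fact p)) = G (z, p)" for p
      by (simp add: G_def pochhammer_product'[of a "i + j" p])
    moreover have "?c * (1 - t) powr (- (a + of_nat (i + j))) = (1 - t) powr (- a) * R z"
    proof -
      have "(1 - t) powr (- (a + of_nat (i + j)))
          = (1 - t) powr (- a) / ((1 - t) ^ i * (1 - t) ^ j)"
        using t1 powr_nat'[of "1 - t" "i + j"] powr_diff[of "1 - t" "- a" "of_nat (i + j)"]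
        by (simp add: power_add algebra_simps)
      moreover have "- (y * t / (1 - t)) = - (y * t) / (1 - t)" by simp
      ultimately show ?thesis by (simp only: R_def power_divide prod.case \<open>z = (i, j)\<close>) (simp add: ac_simps)
    qed
    ultimately show ?thesis by simp
  qed
  have "(G has_sum infsum G UNIV) (UNIV \<times> UNIV)" using summ by simp
  from has_sum_SigmaD[OF this inner]
  have outer: "((\<lambda>z. (1 - t) powr (- a) * R z) has_sum infsum G UNIV) UNIV" .
  have total: "infsum G UNIV
      = (1 - t) powr (- a) * appell_sum a A B (x / (1 - t)) (- (y * t / (1 - t)))"
    using infsumI[OF outer] by (simp add: infsum_cmult_right' appell_sum_def R_def)

  define F where "F = (\<lambda>n i. pochhammer (a + of_nat n) i * A i * (x ^ i / fact i))"
  define K where "K = (\<lambda>n j. pochhammer (- of_nat n) j * B j * (y ^ j / fact j))"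
  define H where "H = (\<lambda>(n, j, i). pochhammer a n / fact n * t ^ n * (F n i * K n j))"
  have GH: "G ((i, j), n - j) = H (n, j, i)" if "j \<le> n" for n i j
  proof -
    have P: "pochhammer a (i + j + (n - j)) = pochhammer a n * pochhammer (a + of_nat n) i"
      using that pochhammer_product'[of a n i] by (simp add: add.commute)
    have T: "t ^ n = t ^ j * t ^ (n - j)" using that by (simp flip: power_add)
    have "- (y * t) = (-1) * y * t" by simp
    then have S: "(- (y * t)) ^ j = (-1) ^ j * y ^ j * t ^ j"
      by (simp only: power_mult_distrib)
    show ?thesis
      unfolding G_def H_def F_def K_def prod.case P S pochhammer_neg_nat[OF that] T
      by (simp add: ac_simps)
  qed
  \<comment> \<open>The index \<open>(i, j, p)\<close> corresponds to \<open>(n, j, i)\<close> with \<open>n = j + p\<close>, hence \<open>j \<le> n\<close>.\<close>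
  have "(G has_sum infsum G UNIV) UNIV \<longleftrightarrow>
      (H has_sum infsum G UNIV) (Sigma UNIV (\<lambda>n. {..n} \<times> UNIV))"
    by (rule has_sum_reindex_bij_witness
        [where j = "\<lambda>((i, j), p). (j + p, j, i)" and i = "\<lambda>(n, j, i). ((i, j), n - j)"])
      (use GH[symmetric] in auto)
  then have H: "(H has_sum infsum G UNIV) (Sigma UNIV (\<lambda>n. {..n} \<times> UNIV))"
    using summ by simp
  \<comment> \<open>Convergence of the inner series cannot be read off from \<open>H\<close>, whose prefactor may vanish.\<close>
  have F_sum: "(F n has_sum suminf (F n)) UNIV" for n
  proof -
    have "subexponential (\<lambda>i. pochhammer (a + of_nat n) i / fact i * A i)"
      by (intro subexponential_mult subexponential_pochhammer_fact A)
    from subexponential_power_series_summable[OF this x]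
    have "summable (\<lambda>i. norm (F n i))" by (simp add: F_def mult_ac)
    from norm_summable_imp_has_sum[OF this summable_sums[OF summable_norm_cancel[OF this]]]
    show ?thesis .
  qed
  have K_sum: "suminf (K n) = sum (K n) {..n}" for n
  proof (rule suminf_finite)
    fix j assume "j \<notin> {..n}"
    then show "K n j = 0" by (simp add: K_def pochhammer_of_nat_eq_0_lemma)
  qed simp
  have "((\<lambda>n. pochhammer a n / fact n * t ^ n * (suminf (F n) * suminf (K n)))
      has_sum infsum G UNIV) UNIV"
  proof (rule has_sum_SigmaD[OF H])
    fix n :: nat
    show "((\<lambda>z. H (n, z)) has_sum pochhammer a n / fact n * t ^ n * (suminf (F n) * suminf (K n)))
        ({..n} \<times> UNIV)"
    proof (rule has_sum_SigmaI)
      show "((\<lambda>i. H (n, j, i)) has_sum pochhammer a n / fact n * t ^ n * (suminf (F n) * K n j)) UNIV" for j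
        unfolding H_def prod.case by (intro has_sum_cmult_right has_sum_cmult_left F_sum)
      show "((\<lambda>j. pochhammer a n / fact n * t ^ n * (suminf (F n) * K n j))
          has_sum pochhammer a n / fact n * t ^ n * (suminf (F n) * suminf (K n))) {..n}"
        by (intro has_sum_finiteI) (simp_all add: K_sum sum_distrib_left)
      show "(\<lambda>z. H (n, z)) summable_on {..n} \<times> UNIV"
        by (rule summable_on_SigmaD1[where A = UNIV])
          (use has_sum_imp_summable[OF H] in \<open>simp_all add: case_prod_unfold\<close>)
    qed
  qed
  from has_sum_imp_sums[OF this]
  have "(\<lambda>n. pochhammer a n / fact n * suminf (F n) * suminf (K n) * t ^ n) sums infsum G UNIV"
    by (simp only: mult_ac)
  then show ?thesis
    unfolding total F_def K_def .
qed

section \<open>Analytic continuation\<close>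

text \<open>
  Near each point the arguments stay below constants \<open>u, v\<close> with \<open>u + v < 1\<close>, so the Weierstrass
  test applies with the double series at \<open>u, v\<close> as majorant.
\<close>

lemma appell_sum_holomorphic:
  assumes A: "subexponential A" and B: "subexponential B"
    and g: "g holomorphic_on S" and h: "h holomorphic_on S" and S: "open S"
    and less: "\<And>z. z \<in> S \<Longrightarrow> norm (g z) + norm (h z) < 1"
  shows "(\<lambda>z. appell_sum a A B (g z) (h z)) holomorphic_on S"
proof (rule analytic_imp_holomorphic, unfold analytic_on_def, rule ballI)
  fix z assume z: "z \<in> S"
  define e where "e = (1 - norm (g z) - norm (h z)) / 3"
  have e: "e > 0" using less[OF z] by (simp add: e_def)
  define u v where "u = norm (g z) + e" and "v = norm (h z) + e"
  have uv: "0 \<le> u" "0 \<le> v" "u + v < 1"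
    using e less[OF z] by (simp_all add: u_def v_def) (simp add: e_def field_simps)
  have "isCont g z" "isCont h z"
    using z S g h holomorphic_on_imp_continuous_on continuous_on_eq_continuous_at by blast+
  then have "((\<lambda>w. norm (g w)) \<longlongrightarrow> norm (g z)) (nhds z)" "((\<lambda>w. norm (h w)) \<longlongrightarrow> norm (h z)) (nhds z)"
    by (auto intro!: tendsto_norm simp: continuous_at tendsto_at_iff_tendsto_nhds)
  then have "eventually (\<lambda>w. norm (g w) < u) (nhds z)" "eventually (\<lambda>w. norm (h w) < v) (nhds z)"
    using e by (auto intro!: order_tendstoD simp: u_def v_def)
  moreover have "eventually (\<lambda>w. w \<in> S) (nhds z)" using S z by (rule eventually_nhds_in_open)
  ultimately have "eventually (\<lambda>w. w \<in> S \<and> norm (g w) < u \<and> norm (h w) < v) (nhds z)"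
    by eventually_elim auto
  then obtain r where r: "r > 0" "\<And>w. w \<in> cball z r \<Longrightarrow> w \<in> S \<and> norm (g w) < u \<and> norm (h w) < v"
    unfolding eventually_nhds_metric_le by (auto simp: dist_commute)
  let ?f = "\<lambda>(i, j) w. pochhammer a (i + j) * A i * B j * (g w ^ i / fact i) * (h w ^ j / fact j)"
  have lim: "uniform_limit (cball z r) (\<lambda>X w. \<Sum>ij\<in>X. ?f ij w)
      (\<lambda>w. \<Sum>\<^sub>\<infinity>ij\<in>UNIV. ?f ij w) (finite_subsets_at_top UNIV)"
  proof (rule Weierstrass_m_test_general)
    show "(\<lambda>(i, j). norm (pochhammer a (i + j) * A i * B j) * (u ^ i / fact i) * (v ^ j / fact j))
        summable_on UNIV"
      by (rule appell_series_summable[OF A B uv])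
    fix ij :: "nat \<times> nat" and w assume "w \<in> cball z r"
    then have "norm (g w) \<le> u" "norm (h w) \<le> v" using r(2) by (auto intro: less_imp_le)
    then show "norm (?f ij w) \<le> (\<lambda>(i, j). norm (pochhammer a (i + j) * A i * B j)
        * (u ^ i / fact i) * (v ^ j / fact j)) ij"
      using uv by (cases ij, simp only: prod.case norm_mult norm_divide norm_power norm_fact)
        (intro mult_mono divide_right_mono power_mono mult_nonneg_nonneg; simp)
  qed
  have hol: "(\<lambda>w. \<Sum>ij\<in>X. ?f ij w) holomorphic_on cball z r" for X
  proof -
    have "cball z r \<subseteq> S" using r(2) by blast
    then have "g holomorphic_on cball z r" "h holomorphic_on cball z r"
      using g h holomorphic_on_subset by blast+
    then show ?thesis by (auto simp: case_prod_unfold intro!: holomorphic_intros)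
  qed
  have ev: "\<forall>\<^sub>F X in finite_subsets_at_top UNIV. continuous_on (cball z r) (\<lambda>w. \<Sum>ij\<in>X. ?f ij w)
      \<and> (\<lambda>w. \<Sum>ij\<in>X. ?f ij w) holomorphic_on ball z r"
    using holomorphic_on_imp_continuous_on[OF hol] holomorphic_on_subset[OF hol ball_subset_cball]
    by (intro always_eventually) blast
  have "(\<lambda>w. \<Sum>\<^sub>\<infinity>ij\<in>UNIV. ?f ij w) holomorphic_on ball z r"
    by (rule holomorphic_uniform_limit[OF ev lim finite_subsets_at_top_neq_bot])
  then show "\<exists>\<epsilon>>0. (\<lambda>z. appell_sum a A B (g z) (h z)) holomorphic_on ball z \<epsilon>"
    using r(1) by (auto simp: appell_sum_def case_prod_unfold)
qed

text \<open>
  The norm of \<open>c n * z ^ n\<close> depends on \<open>z\<close> only through its modulus, so absolute convergence at the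
  single point \<open>t\<close> is uniform convergence on the closed disc.
\<close>

lemma power_series_disc_regularity:
  fixes c :: "nat \<Rightarrow> complex"
  assumes "summable (\<lambda>n. norm (c n * t ^ n))"
  shows "continuous_on (cball 0 (norm t)) (\<lambda>z. \<Sum>n. c n * z ^ n)"
    and "(\<lambda>z. \<Sum>n. c n * z ^ n) holomorphic_on ball 0 (norm t)"
proof -
  have lim: "uniform_limit (cball 0 (norm t)) (\<lambda>N z. \<Sum>n<N. c n * z ^ n)
      (\<lambda>z. \<Sum>n. c n * z ^ n) sequentially"
  proof (rule Weierstrass_m_test[OF _ assms])
    fix n and z :: complex assume "z \<in> cball 0 (norm t)"
    then show "norm (c n * z ^ n) \<le> norm (c n * t ^ n)"
      by (auto simp: norm_mult norm_power intro!: mult_left_mono power_mono)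
  qed
  have "\<forall>\<^sub>F N in sequentially. continuous_on (cball 0 (norm t)) (\<lambda>z. \<Sum>n<N. c n * z ^ n)
      \<and> (\<lambda>z. \<Sum>n<N. c n * z ^ n) holomorphic_on ball 0 (norm t)"
    by (intro always_eventually allI conjI continuous_intros holomorphic_intros)
  from holomorphic_uniform_limit[OF this lim]
  show "continuous_on (cball 0 (norm t)) (\<lambda>z. \<Sum>n. c n * z ^ n)"
    and "(\<lambda>z. \<Sum>n. c n * z ^ n) holomorphic_on ball 0 (norm t)"
    by simp_all
qed

text \<open>
  By Thales' theorem the angle at \<open>z\<close> in the triangle with vertices \<open>-|z|\<close>, \<open>z\<close> and \<open>|z|\<close> is
  right. As \<open>1\<close> lies at or beyond \<open>|z|\<close>, the angle at \<open>z\<close> between the chord and the segment to \<open>1\<close>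
  is at least right, and moving along the chord leads away from \<open>1\<close>.
\<close>

lemma dist_one_along_chord:
  fixes z w :: complex
  assumes z: "norm z \<le> 1" and w: "w \<in> closed_segment z (- of_real (norm z))"
  shows "norm (1 - z) \<le> norm (1 - w)"
proof -
  define \<rho> where "\<rho> = norm z"
  obtain s where s: "0 \<le> s" "w = (1 - s) *\<^sub>R z + s *\<^sub>R (- of_real \<rho>)"
    using w unfolding closed_segment_def \<rho>_def by auto
  have \<rho>2: "\<rho>\<^sup>2 = (Re z)\<^sup>2 + (Im z)\<^sup>2" by (simp add: \<rho>_def cmod_power2)
  have "- \<rho> \<le> Re z" unfolding \<rho>_def by (meson abs_Re_le_cmod abs_le_iff minus_le_iff)
  then have pos: "0 \<le> (1 - \<rho>) * (Re z + \<rho>)" using z by (simp add: \<rho>_def)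
  have "(norm (1 - w))\<^sup>2 - (norm (1 - z))\<^sup>2
      = 2 * s * ((1 - \<rho>) * (Re z + \<rho>) + (\<rho>\<^sup>2 - (Re z)\<^sup>2 - (Im z)\<^sup>2)) + s\<^sup>2 * ((Re z + \<rho>)\<^sup>2 + (Im z)\<^sup>2)"
    unfolding cmod_power2 s(2) by (simp add: power2_eq_square algebra_simps)
  also have "\<dots> = 2 * s * ((1 - \<rho>) * (Re z + \<rho>)) + s\<^sup>2 * ((Re z + \<rho>)\<^sup>2 + (Im z)\<^sup>2)"
    using \<rho>2 by simp
  also have "\<dots> \<ge> 0"
    using mult_nonneg_nonneg[OF s(1) pos] by (intro add_nonneg_nonneg) auto
  finally have "(norm (1 - z))\<^sup>2 \<le> (norm (1 - w))\<^sup>2" by linarith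
  then show ?thesis by (rule power2_le_imp_le) (rule norm_ge_zero)
qed

text \<open>
  Every point \<open>z\<close> of the region is joined to the origin by the chord from \<open>z\<close> to \<open>-|z|\<close>, along which
  \<open>|w|\<close> does not exceed \<open>|z|\<close> and \<open>|1 - w|\<close> is at least \<open>|1 - z|\<close>, followed by a piece of the
  negative real axis, on which the defining inequality is affine in \<open>|w|\<close>.
\<close>

lemma appell_disc_region_connected:
  fixes p q r :: real
  assumes p: "p < 1" and q: "0 \<le> q" and r: "r \<le> 1"
  shows "connected {z :: complex. norm z < r \<and> p + q * norm z < norm (1 - z)}" (is "connected ?D")
proof (cases "r > 0")
  case True
  have to_0: "connected_component ?D z 0" if z: "z \<in> ?D" for z
    unfolding connected_component_def
  proof (intro exI conjI)
    define b :: complex where "b = - of_real (norm z)"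
    let ?T = "closed_segment z b \<union> closed_segment b 0"
    show "connected ?T" by (rule connected_Un) auto
    show "z \<in> ?T" "0 \<in> ?T" by auto
    have z': "norm z < r" "p + q * norm z < norm (1 - z)" using z by auto
    have "w \<in> ?D" if w: "w \<in> closed_segment z b" for w
    proof -
      have "norm w \<le> norm z"
        using w closed_segment_subset[of z "cball 0 (norm z)" b] by (auto simp: b_def)
      moreover have "norm (1 - z) \<le> norm (1 - w)"
        using w z' r by (intro dist_one_along_chord) (auto simp: b_def)
      ultimately show ?thesis using z' mult_left_mono[OF _ q, of "norm w" "norm z"] by simp
    qed
    moreover have "w \<in> ?D" if w: "w \<in> closed_segment b 0" for w
    proof -
      obtain s where s: "0 \<le> s" "s \<le> 1" "w = (1 - s) *\<^sub>R b" using w by (auto simp: closed_segment_def)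
      define \<sigma> where "\<sigma> = (1 - s) * norm z"
      have \<sigma>: "0 \<le> \<sigma>" "\<sigma> \<le> norm z" using s by (auto simp: \<sigma>_def mult_left_le_one_le)
      have w: "w = - of_real \<sigma>" by (simp add: s(3) b_def \<sigma>_def scaleR_conv_of_real)
      have "1 - w = of_real (1 + \<sigma>)" by (simp add: w)
      then have nw: "norm w = \<sigma>" "norm (1 - w) = 1 + \<sigma>"
        using \<sigma> w by (simp_all only: norm_minus_cancel norm_of_real)
      have "p + q * norm z < 1 + norm z" using z'(2) norm_triangle_ineq4[of 1 z] by simp
      then have "(1 - s) * (p + q * norm z) \<le> (1 - s) * (1 + norm z)"
        using s by (intro mult_left_mono) auto
      moreover have "s * p \<le> s * 1" using s p by (intro mult_left_mono) auto
      moreover have "p + q * \<sigma> = (1 - s) * (p + q * norm z) + s * p"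
        by (simp add: \<sigma>_def algebra_simps)
      moreover have "1 + \<sigma> = (1 - s) * (1 + norm z) + s * 1"
        by (simp add: \<sigma>_def algebra_simps)
      moreover have "s * p < s * 1" if "s \<noteq> 0" using that s p by simp
      moreover have "(1 - s) * (p + q * norm z) < (1 - s) * (1 + norm z)" if "s = 0"
        using that \<open>p + q * norm z < 1 + norm z\<close> by simp
      ultimately have "p + q * \<sigma> < 1 + \<sigma>" by (cases "s = 0") linarith+
      then show ?thesis using nw \<sigma> z' by simp
    qed
    ultimately show "?T \<subseteq> ?D" by blast
  qed
  show ?thesis
    unfolding connected_iff_connected_component
    by (intro ballI connected_component_trans[OF to_0 connected_component_sym[OF to_0]])
next
  case False
  then have "\<not> norm z < r" for z :: complex using norm_ge_zero[of z] by linarith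
  then show ?thesis by simp
qed

text \<open>
  The power series \<open>L\<close> and the closed form \<open>R\<close> agree near the origin, hence on the connected region
  \<open>D\<close>. If \<open>t \<noteq> 0\<close>, then \<open>t\<close> lies on the boundary of \<open>D\<close> and is reached as a limit along its radius: \<open>L\<close> is
  continuous on the closed disc and \<open>R\<close> is holomorphic on the region \<open>U\<close>, which contains \<open>t\<close>.
\<close>

theorem appell_generating_function:
  fixes a x y t :: complex
  assumes A: "subexponential A" and B: "subexponential B"
    and x: "norm x < 1" and t: "norm t < 1"
    and region: "norm (x / (1 - t)) + norm (y * t / (1 - t)) < 1"
    and summ: "summable (\<lambda>n. norm (pochhammer a n / fact n
            * (\<Sum>i. pochhammer (a + of_nat n) i * A i * (x ^ i / fact i))
            * (\<Sum>j. pochhammer (- of_nat n) j * B j * (y ^ j / fact j)) * t ^ n))"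
  shows "(\<Sum>n. pochhammer a n / fact n
            * (\<Sum>i. pochhammer (a + of_nat n) i * A i * (x ^ i / fact i))
            * (\<Sum>j. pochhammer (- of_nat n) j * B j * (y ^ j / fact j)) * t ^ n)
         = (1 - t) powr (- a) * appell_sum a A B (x / (1 - t)) (- (y * t / (1 - t)))"
proof (cases "t = 0")
  case True
  then show ?thesis
    using appell_generating_function_near_0[OF A B, of x y t a] x by (simp add: sums_iff)
next
  case False
  define c where "c = (\<lambda>n. pochhammer a n / fact n
            * (\<Sum>i. pochhammer (a + of_nat n) i * A i * (x ^ i / fact i))
            * (\<Sum>j. pochhammer (- of_nat n) j * B j * (y ^ j / fact j)))"
  define L where "L = (\<lambda>z. \<Sum>n. c n * z ^ n)"
  define R where "R = (\<lambda>z. (1 - z) powr (- a) * appell_sum a A B (x / (1 - z)) (- (y * z / (1 - z))))"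
  define U where "U = {z :: complex. norm z < 1 \<and> norm x + norm y * norm z < norm (1 - z)}"
  define D where "D = {z :: complex. norm z < norm t \<and> norm x + norm y * norm z < norm (1 - z)}"
  have open_U: "open U" and open_D: "open D"
    unfolding U_def D_def by (intro open_Collect_conj open_Collect_less continuous_intros)+
  have DU: "D \<subseteq> U" using t by (auto simp: U_def D_def)
  have U_iff: "norm (x / (1 - z)) + norm (- (y * z / (1 - z))) < 1 \<longleftrightarrow>
      norm x + norm y * norm z < norm (1 - z)" if "norm z < 1" for z
  proof -
    have "1 - z \<noteq> 0" using that by auto
    then show ?thesis
      by (simp add: norm_divide norm_mult divide_less_eq flip: add_divide_distrib)
  qed
  have tU: "t \<in> U" using region U_iff[OF t] t by (simp add: U_def)
  have hol_R: "R holomorphic_on U"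
  proof -
    have nz: "1 - z \<noteq> 0" if "z \<in> U" for z using that by (auto simp: U_def)
    have "1 - z \<notin> \<real>\<^sub>\<le>\<^sub>0" if "z \<in> U" for z
    proof -
      have "Re z < 1" using that complex_Re_le_cmod[of z] by (simp add: U_def)
      then show ?thesis by (auto simp: complex_nonpos_Reals_iff)
    qed
    then show ?thesis
      unfolding R_def using nz U_iff open_U
      by (intro holomorphic_on_mult holomorphic_on_powr_right holomorphic_intros
          appell_sum_holomorphic[OF A B]) (auto simp: U_def)
  qed
  have L: "continuous_on (cball 0 (norm t)) L" "L holomorphic_on ball 0 (norm t)"
    using power_series_disc_regularity[of c t] summ by (simp_all add: L_def c_def)
  \<comment> \<open>\<open>norm z < e\<close> is the condition \<open>norm x + norm (y * z) + norm z < 1\<close> solved for \<open>norm z\<close>.\<close>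
  define e where "e = (1 - norm x) / (1 + norm y)"
  let ?V = "ball 0 e \<inter> D"
  have LR: "L z = R z" if "z \<in> D" for z
  proof (rule analytic_continuation_open[where s = ?V and s' = D and f = L and g = R])
    have "1 + norm y > 0" using norm_ge_zero[of y] by linarith
    have e: "e > 0" using x \<open>1 + norm y > 0\<close> by (simp add: e_def)
    show "open ?V" using open_D by auto
    have "0 \<in> ?V" using e x False by (simp add: D_def)
    then show "?V \<noteq> {}" by blast
    show "connected D" unfolding D_def
      by (rule appell_disc_region_connected) (use x t in auto)
    show "L holomorphic_on D" by (rule holomorphic_on_subset[OF L(2)]) (auto simp: D_def)
    show "R holomorphic_on D" using hol_R DU by (rule holomorphic_on_subset)
    show "L w = R w" if "w \<in> ?V" for w
    proof -
      have "norm w < e" using that by simp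
      then have "norm w * (1 + norm y) < 1 - norm x"
        using \<open>1 + norm y > 0\<close> by (simp add: e_def pos_less_divide_eq)
      then have "norm x + norm (y * w) + norm w < 1" by (simp add: norm_mult algebra_simps)
      from appell_generating_function_near_0[OF A B this, of a] show ?thesis
        by (simp add: L_def R_def c_def sums_iff)
    qed
  qed (use open_D that in auto)
  define \<tau> where "\<tau> = (\<lambda>m. of_real (1 - inverse (real (Suc m))) * t)"
  have "(\<lambda>m. of_real (1 - inverse (real (Suc m))) * t) \<longlonglongrightarrow> of_real (1 - 0) * t"
    by (intro tendsto_intros LIMSEQ_inverse_real_of_nat)
  then have \<tau>: "\<tau> \<longlonglongrightarrow> t" by (simp add: \<tau>_def)
  have \<tau>_less: "norm (\<tau> m) < norm t" for m
  proof -
    have "\<bar>1 - inverse (real (Suc m))\<bar> < 1" by (simp add: field_simps)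
    then show ?thesis using False by (simp only: \<tau>_def norm_mult norm_of_real) simp
  qed
  have lim_L: "(\<lambda>m. L (\<tau> m)) \<longlonglongrightarrow> L t"
    using \<tau>_less by (intro continuous_on_tendsto_compose[OF L(1) \<tau>])
      (auto intro!: always_eventually less_imp_le)
  have "isCont R t"
    using hol_R open_U tU holomorphic_on_imp_continuous_on continuous_on_eq_continuous_at by blast
  then have lim_R: "(\<lambda>m. R (\<tau> m)) \<longlonglongrightarrow> R t" using \<tau> by (rule isCont_tendsto_compose)
  have "\<forall>\<^sub>F m in sequentially. \<tau> m \<in> U"
    using \<tau> open_U tU by (rule topological_tendstoD)
  then have "\<forall>\<^sub>F m in sequentially. L (\<tau> m) = R (\<tau> m)"
    by eventually_elim (use \<tau>_less LR in \<open>auto simp: U_def D_def\<close>)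
  with lim_L have "(\<lambda>m. R (\<tau> m)) \<longlonglongrightarrow> L t" by (rule Lim_transform_eventually)
  then have "L t = R t" using lim_R by (rule LIMSEQ_unique)
  then show ?thesis unfolding L_def R_def c_def .
qed

section \<open>Reduction of the k-symbols to ordinary Pochhammer symbols\<close>

lemma pochhammer_k_conv_pochhammer:
  assumes "k \<noteq> 0"
  shows "pochhammer_k k a n = of_real k ^ n * pochhammer (a / of_real k) n"
proof -
  have "a + of_nat i * of_real k = of_real k * (a / of_real k + of_nat i)" for i
    using assms by (simp add: field_simps)
  then show ?thesis
    by (simp add: pochhammer_k_def pochhammer_prod prod.distrib lessThan_atLeast0)
qed

lemma hyp2F1_k_conv_pochhammer:
  assumes "k \<noteq> 0"
  shows "hyp2F1_k k a b c x = (\<Sum>i. pochhammer (a / of_real k) i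
    * (pochhammer (b / of_real k) i / pochhammer (c / of_real k) i) * ((of_real k * x) ^ i / fact i))"
  unfolding hyp2F1_k_def pochhammer_k_conv_pochhammer[OF assms] power_mult_distrib
  using assms by (simp add: ac_simps)

lemma appellF2_k_conv_appell_sum:
  assumes "k \<noteq> 0"
  shows "appellF2_k k a b b' c c' x y = appell_sum (a / of_real k)
    (\<lambda>i. pochhammer (b / of_real k) i / pochhammer (c / of_real k) i)
    (\<lambda>j. pochhammer (b' / of_real k) j / pochhammer (c' / of_real k) j)
    (of_real k * x) (of_real k * y)"
  unfolding appellF2_k_def appell_sum_def pochhammer_k_conv_pochhammer[OF assms]
    power_mult_distrib power_add
  using assms by (simp add: ac_simps)

theorem theorem18:
  fixes k :: real and lam \<alpha> \<beta> \<gamma> \<delta> x y t :: complex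
  assumes "k > 0"
    and "\<And>n::nat. \<beta> \<noteq> - (of_nat n * of_real k)"
    and "\<And>n::nat. \<delta> \<noteq> - (of_nat n * of_real k)"
    and "norm x < 1 / k"
    and "norm t < 1 / k"
    and "norm (x / (1 - of_real k * t)) + norm (of_real k * y * t / (1 - of_real k * t)) < 1 / k"
    and "summable (\<lambda>n. norm (pochhammer_k k lam n / fact n
           * hyp2F1_k k (lam + of_nat n * of_real k) \<alpha> \<beta> x
           * hyp2F1_k k (- (of_nat n * of_real k)) \<gamma> \<delta> y * t ^ n))"
  shows "(\<Sum>n. pochhammer_k k lam n / fact n
           * hyp2F1_k k (lam + of_nat n * of_real k) \<alpha> \<beta> x
           * hyp2F1_k k (- (of_nat n * of_real k)) \<gamma> \<delta> y * t ^ n)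
       = (1 - of_real k * t) powr (- (lam / of_real k))
           * appellF2_k k lam \<alpha> \<gamma> \<beta> \<delta>
               (x / (1 - of_real k * t)) (- (of_real k * y * t / (1 - of_real k * t)))"
proof -
  let ?k = "of_real k :: complex"
  have k: "k \<noteq> 0" using assms(1) by simp
  define A where "A = (\<lambda>i. pochhammer (\<alpha> / ?k) i / pochhammer (\<beta> / ?k) i)"
  define B where "B = (\<lambda>j. pochhammer (\<gamma> / ?k) j / pochhammer (\<delta> / ?k) j)"
  have sub: "subexponential A" "subexponential B"
    unfolding A_def B_def using assms(2,3) k
    by (auto intro!: subexponential_pochhammer_quotient simp: field_simps minus_equation_iff)
  have term_eq: "pochhammer_k k lam n / fact n
           * hyp2F1_k k (lam + of_nat n * of_real k) \<alpha> \<beta> x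
           * hyp2F1_k k (- (of_nat n * of_real k)) \<gamma> \<delta> y * t ^ n
      = pochhammer (lam / ?k) n / fact n
            * (\<Sum>i. pochhammer (lam / ?k + of_nat n) i * A i * ((?k * x) ^ i / fact i))
            * (\<Sum>j. pochhammer (- of_nat n) j * B j * ((?k * y) ^ j / fact j)) * (?k * t) ^ n" for n
  proof -
    have "(lam + of_nat n * ?k) / ?k = lam / ?k + of_nat n" "- (of_nat n * ?k) / ?k = - of_nat n"
      using k by (simp_all add: field_simps)
    then show ?thesis
      by (simp add: pochhammer_k_conv_pochhammer[OF k] hyp2F1_k_conv_pochhammer[OF k]
          A_def B_def power_mult_distrib)
  qed
  have scale: "norm (?k * z) = k * norm z" for z using assms(1) by (simp add: norm_mult)
  have x: "norm (?k * x) < 1" and t: "norm (?k * t) < 1"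
    using assms(1,4,5) by (simp_all only: scale) (simp_all add: pos_less_divide_eq mult.commute)
  have args: "?k * (x / (1 - ?k * t)) = ?k * x / (1 - ?k * t)"
      "?k * (?k * y * t / (1 - ?k * t)) = ?k * y * (?k * t) / (1 - ?k * t)"
      "?k * (- (?k * y * t / (1 - ?k * t))) = - (?k * y * (?k * t) / (1 - ?k * t))"
    by simp_all
  have "norm (?k * x / (1 - ?k * t)) + norm (?k * y * (?k * t) / (1 - ?k * t))
      = k * (norm (x / (1 - ?k * t)) + norm (?k * y * t / (1 - ?k * t)))"
    unfolding args(1,2)[symmetric] scale by (rule distrib_left [symmetric])
  also have "\<dots> < 1"
    using assms(1,6) by (simp only: pos_less_divide_eq mult.commute)
  finally have region: "norm (?k * x / (1 - ?k * t)) + norm (?k * y * (?k * t) / (1 - ?k * t)) < 1" .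
  have appell_eq: "appellF2_k k lam \<alpha> \<gamma> \<beta> \<delta>
               (x / (1 - ?k * t)) (- (?k * y * t / (1 - ?k * t)))
      = appell_sum (lam / ?k) A B (?k * x / (1 - ?k * t)) (- (?k * y * (?k * t) / (1 - ?k * t)))"
    by (simp only: appellF2_k_conv_appell_sum[OF k] A_def B_def args)
  have summ: "summable (\<lambda>n. norm (pochhammer (lam / ?k) n / fact n
            * (\<Sum>i. pochhammer (lam / ?k + of_nat n) i * A i * ((?k * x) ^ i / fact i))
            * (\<Sum>j. pochhammer (- of_nat n) j * B j * ((?k * y) ^ j / fact j)) * (?k * t) ^ n))"
    using assms(7) by (simp only: term_eq)
  show ?thesis
    unfolding appell_eq term_eq
    by (rule appell_generating_function[OF sub x t region summ])
qed

end
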